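(* Let $N\ge 1$. For every $u\in C_{0}^{\infty}(\mathbb{H}^{N})\setminus\{0\}$, $$\begin{aligned}&\left(\int_{\mathbb{H}^{N}}|\nabla_{\mathbb{H}}u|^{2}dV_{\mathbb{H}}\right)^{1/2}\left(\int_{\mathbb{H}^{N}}\rho^{2}(x)|u|^{2}dV_{\mathbb{H}}\right)^{1/2}-\frac12\int_{\mathbb{H}^{N}}\left(N+(N-1)\frac{\rho(x)\cosh\rho(x)-\sinh\rho(x)}{\sinh\rho(x)}\right)|u|^{2}dV_{\mathbb{H}}\\&=\frac{\lambda^{2}}{2}\int_{\mathbb{H}^{N}}e^{-\frac{\rho^{2}(x)}{\lambda^{2}}}\left|\nabla_{\mathbb{H}}\left(ue^{\frac{\rho^{2}(x)}{2\lambda^{2}}}\right)\right|^{2}dV_{\mathbb{H}}\end{aligned}$$ with $$\lambda=\left(\frac{\int_{\mathbb{H}^{N}}\rho^{2}(x)|u|^{2}dV_{\mathbb{H}}}{\int_{\mathbb{H}^{N}}|\nabla_{\mathbb{H}}u|^{2}dV_{\mathbb{H}}}\right)^{1/4}.$$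
   Context: $\mathbb{H}^{N}$ is the hyperbolic space in the Poincaré ball model: the Euclidean unit ball with Riemannian metric $\left(\frac{2}{1-|x|^{2}}\right)^{2}dx^{2}$, volume element $dV_{\mathbb{H}}=\left(\frac{2}{1-|x|^{2}}\right)^{N}dx$, Riemannian gradient $\nabla_{\mathbb{H}}=\left(\frac{1-|x|^{2}}{2}\right)^{2}\nabla$; $|\nabla_{\mathbb H}u|$ is the Riemannian norm. $\rho(x)=\log\frac{1+|x|}{1-|x|}$ is the hyperbolic distance from $x$ to $0$. Functions are real-valued; $C_0^\infty$ means smooth with compact support. *)

theory Defs
  imports "HOL-Analysis.Analysis"
begin

text \<open>
  Smoothness and compact support are meant for an open set \<open>S\<close>; the values of the function outside \<open>S\<close>
  are irrelevant.
\<close>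

primrec Ck_on :: "nat \<Rightarrow> 'a::euclidean_space set \<Rightarrow> ('a \<Rightarrow> real) \<Rightarrow> bool" where
  "Ck_on 0 S f \<longleftrightarrow> continuous_on S f"
| "Ck_on (Suc k) S f \<longleftrightarrow>
     (\<forall>x\<in>S. f differentiable at x) \<and> (\<forall>v. Ck_on k S (\<lambda>x. frechet_derivative f (at x) v))"

definition smooth_on :: "'a::euclidean_space set \<Rightarrow> ('a \<Rightarrow> real) \<Rightarrow> bool" where
  "smooth_on S f \<longleftrightarrow> (\<forall>k. Ck_on k S f)"

text \<open>The support is the closure relative to \<open>S\<close> of the set where \<open>f\<close> does not vanish.\<close>

definition test_function_on :: "'a::euclidean_space set \<Rightarrow> ('a \<Rightarrow> real) \<Rightarrow> bool" where
  "test_function_on S f \<longleftrightarrow> smooth_on S f \<and> compact (S \<inter> closure {x \<in> S. f x \<noteq> 0})"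

text \<open>
  The Poincare ball model of dimension \<open>N = DIM('a)\<close>; every Euclidean space has
  \<open>DIM('a) \<ge> 1\<close>. Tangent vectors at a point are elements of \<open>'a\<close>.
\<close>

definition hyp_space :: "'a::euclidean_space set" where
  "hyp_space = ball 0 1"

definition hyp_metric :: "'a::euclidean_space \<Rightarrow> 'a \<Rightarrow> 'a \<Rightarrow> real" where
  "hyp_metric x v w = (2 / (1 - (norm x)\<^sup>2))\<^sup>2 * (v \<bullet> w)"

definition hyp_norm :: "'a::euclidean_space \<Rightarrow> 'a \<Rightarrow> real" where
  "hyp_norm x v = sqrt (hyp_metric x v v)"

definition hyp_vol :: "'a::euclidean_space measure" where
  "hyp_vol = density (restrict_space lborel hyp_space)
     (\<lambda>x. ennreal ((2 / (1 - (norm x)\<^sup>2)) ^ DIM('a)))"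

definition euclidean_grad :: "('a::euclidean_space \<Rightarrow> real) \<Rightarrow> 'a \<Rightarrow> 'a" where
  "euclidean_grad f x = (THE D. GDERIV f x :> D)"

definition hyp_grad :: "('a::euclidean_space \<Rightarrow> real) \<Rightarrow> 'a \<Rightarrow> 'a" where
  "hyp_grad f x = ((1 - (norm x)\<^sup>2) / 2)\<^sup>2 *\<^sub>R euclidean_grad f x"

definition hyp_rho :: "'a::euclidean_space \<Rightarrow> real" where
  "hyp_rho x = ln ((1 + norm x) / (1 - norm x))"

end

theory Submission
  imports Defs
begin

text \<open>
  Write \<open>p = 2 / (1 - |x|\<^sup>2)\<close>. Since \<open>|\<nabla>\<rho>| = 1\<close>, expanding the square on the right gives
  \<open>A - K / \<lambda>\<^sup>2 + B / \<lambda>\<^sup>4\<close>, where \<open>A\<close> and \<open>B\<close> are the integrals on the left and the cross term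
  \<open>- K\<close> is evaluated by partial integration: \<open>\<integral> 2 u \<rho> \<langle>\<nabla>u, \<nabla>\<rho>\<rangle> dV = - \<integral> u\<^sup>2 div (\<rho> \<nabla>\<rho>) dV\<close>. As \<open>\<rho> \<nabla>\<rho>\<close>
  is radial, this partial integration is Euler's identity \<open>\<integral> x \<bullet> \<nabla>H dx = - N \<integral> H dx\<close> applied to
  \<open>H = (\<rho> / |x|) p\<^bsup>N-1\<^esup> u\<^sup>2\<close>. The choice \<open>\<lambda>\<^sup>4 = B / A\<close> yields the claim. If \<open>A = 0\<close>, the cross term
  vanishes, and so does \<open>u\<close>, because the kernel \<open>div (\<rho> \<nabla>\<rho>)\<close> is positive.
\<close>

section \<open>Dilations of Lebesgue measure and Euler's identity\<close>

lemma integral_lborel_scaleR: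
  fixes f :: "'a::euclidean_space \<Rightarrow> real"
  assumes "c \<noteq> 0" and f[measurable]: "f \<in> borel_measurable borel"
  shows "(\<integral>x. f x \<partial>lborel) = \<bar>c\<bar> ^ DIM('a) * (\<integral>x. f (c *\<^sub>R x) \<partial>lborel)"
  by (subst lborel_affine[OF assms(1), of 0])
     (simp add: integral_density integral_distr)

lemma integrable_lborel_scaleR:
  fixes f :: "'a::euclidean_space \<Rightarrow> real"
  assumes c: "c \<noteq> 0" and f: "integrable lborel f"
  shows "integrable lborel (\<lambda>x. f (c *\<^sub>R x))"
proof -
  have [measurable]: "f \<in> borel_measurable borel"
    using f by auto
  have "integrable (density (distr lborel borel (\<lambda>x. 0 + c *\<^sub>R x)) (\<lambda>_. ennreal (\<bar>c\<bar> ^ DIM('a)))) f"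
    using f lborel_affine[OF c, of "0::'a"] by (simp add: ennreal_power)
  then have "integrable lborel (\<lambda>x. \<bar>c\<bar> ^ DIM('a) * f (c *\<^sub>R x))"
    by (simp add: integrable_density integrable_distr_eq)
  with c show ?thesis
    by simp
qed

lemma DERIV_along_ray:
  fixes H :: "'a::real_inner \<Rightarrow> real"
  assumes "GDERIV H (t *\<^sub>R x) :> G"
  shows "((\<lambda>s. H (s *\<^sub>R x)) has_real_derivative (x \<bullet> G)) (at t)"
proof -
  have "((\<lambda>s. s *\<^sub>R x) has_derivative (\<lambda>h. h *\<^sub>R x)) (at t)"
    by (auto intro!: derivative_eq_intros)
  from has_derivative_compose[OF this assms[unfolded gderiv_def]]
  show ?thesis
    unfolding has_field_derivative_def by (simp add: mult_commute_abs)
qed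

text \<open>
  Differentiating \<open>s\<^sup>N \<integral> H (s x) dx = \<integral> H (x) dx\<close> at \<open>s = 1\<close>. Every ray stays away from
  the origin, so no regularity is needed there.
\<close>

lemma integral_inner_gderiv:
  fixes H :: "'a::euclidean_space \<Rightarrow> real" and G :: "'a \<Rightarrow> 'a"
  assumes H: "integrable lborel H"
    and G[measurable]: "(\<lambda>x. x \<bullet> G x) \<in> borel_measurable borel"
    and deriv: "\<And>x. x \<noteq> 0 \<Longrightarrow> GDERIV H x :> G x"
    and bound: "\<And>x. \<bar>x \<bullet> G x\<bar> \<le> M"
    and supp: "\<And>x. norm x > R \<Longrightarrow> H x = 0"
  shows "(\<integral>x. x \<bullet> G x \<partial>lborel) = - real DIM('a) * (\<integral>x. H x \<partial>lborel)"
proof -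
  \<comment> \<open>The factors tend to 1 from above, so \<open>s n *\<^sub>R x\<close> lies farther
    out than \<open>x\<close>; this keeps the support of every difference quotient
    \<open>f n\<close> inside \<open>cball 0 R\<close>.\<close>
  define s where "s n = 1 + inverse (real (Suc n))" for n
  define f where "f n x = (H (s n *\<^sub>R x) - H x) / (s n - 1)" for n x
  have s1: "s n > 1" for n
    by (simp add: s_def)
  have s_lim: "filterlim s (at 1) sequentially"
    unfolding filterlim_at
  proof
    show "s \<longlonglongrightarrow> 1"
      unfolding s_def using tendsto_add[OF tendsto_const LIMSEQ_inverse_real_of_nat, of 1] by simp
  qed (use s1 in \<open>auto intro!: always_eventually simp: less_imp_neq[symmetric]\<close>)
  have [measurable]: "H \<in> borel_measurable borel"
    using H by auto
  have [measurable]: "f n \<in> borel_measurable borel" for n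
    unfolding f_def by measurable
  have f_bound: "\<bar>f n x\<bar> \<le> M * indicator (cball 0 R) x" for n x
  proof (cases "norm x \<le> R \<and> x \<noteq> 0")
    case False
    have M: "0 \<le> M"
      using bound[of 0] by simp
    have "f n x = 0"
    proof (cases "x = 0")
      case False
      with \<open>\<not> (norm x \<le> R \<and> x \<noteq> 0)\<close> have R: "norm x > R" "norm x > 0"
        by auto
      have "R < s n * norm x"
        using R s1[of n] less_trans[of R "norm x" "s n * norm x"] by simp
      then have "norm (s n *\<^sub>R x) > R"
        using s1[of n] by simp
      with R show ?thesis
        by (simp add: f_def supp)
    qed (simp add: f_def)
    with M show ?thesis
      by (simp add: indicator_def)
  next
    case True
    have "\<exists>z>1. z < s n \<and> H (s n *\<^sub>R x) - H (1 *\<^sub>R x) = (s n - 1) * (x \<bullet> G (z *\<^sub>R x))"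
      using s1 True by (intro MVT2 DERIV_along_ray deriv) auto
    then obtain z where z: "z > 1" "f n x = x \<bullet> G (z *\<^sub>R x)"
      using s1[of n] by (auto simp: f_def)
    \<comment> \<open>The bound \<open>M\<close> pairs a point with the gradient at that same point.
      Since \<open>z > 1\<close>, enlarging \<open>x\<close> to \<open>z *\<^sub>R x\<close> costs
      nothing and makes it applicable.\<close>
    have "\<bar>f n x\<bar> \<le> z * \<bar>x \<bullet> G (z *\<^sub>R x)\<bar>"
      using z mult_right_mono[of 1 z "\<bar>x \<bullet> G (z *\<^sub>R x)\<bar>"] by simp
    also have "\<dots> = \<bar>(z *\<^sub>R x) \<bullet> G (z *\<^sub>R x)\<bar>"
      using z by (simp add: abs_mult)
    also have "\<dots> \<le> M"
      by (rule bound)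
    finally show ?thesis
      using True by simp
  qed
  have f_lim: "(\<lambda>n. f n x) \<longlonglongrightarrow> x \<bullet> G x" if "x \<noteq> 0" for x
  proof -
    have "((\<lambda>t. H (t *\<^sub>R x)) has_real_derivative (x \<bullet> G x)) (at 1)"
      using deriv[OF that] by (intro DERIV_along_ray) simp
    then have "((\<lambda>t. (H (t *\<^sub>R x) - H (1 *\<^sub>R x)) / (t - 1)) \<longlongrightarrow> x \<bullet> G x) (at 1)"
      by (simp add: has_field_derivative_iff)
    from filterlim_compose[OF this s_lim] show ?thesis
      by (simp add: f_def)
  qed
  have lim1: "(\<lambda>n. \<integral>x. f n x \<partial>lborel) \<longlonglongrightarrow> (\<integral>x. x \<bullet> G x \<partial>lborel)"
  proof (rule integral_dominated_convergence)
    show "integrable lborel (\<lambda>x::'a. M * indicator (cball 0 R) x :: real)"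
      using emeasure_lborel_cball_finite[of "0::'a" R]
      by (intro integrable_mult_right integrable_real_indicator) auto
    show "AE x in lborel. (\<lambda>n. f n x) \<longlonglongrightarrow> x \<bullet> G x"
      using AE_lborel_singleton[of "0::'a"] f_lim by auto
  qed (use f_bound in auto)
  have int_f: "(\<integral>x. f n x \<partial>lborel)
      = (inverse (s n) ^ DIM('a) - 1) / (s n - 1) * (\<integral>x. H x \<partial>lborel)" for n
  proof -
    have "(\<integral>x. f n x \<partial>lborel) = ((\<integral>x. H (s n *\<^sub>R x) \<partial>lborel) - (\<integral>x. H x \<partial>lborel)) / (s n - 1)"
      unfolding f_def using H s1[of n] by (simp add: integrable_lborel_scaleR)
    moreover have "(\<integral>x. H (s n *\<^sub>R x) \<partial>lborel) = inverse (s n) ^ DIM('a) * (\<integral>x. H x \<partial>lborel)"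
      using integral_lborel_scaleR[of "s n" H] s1[of n] by (simp add: field_simps)
    ultimately show ?thesis
      by (simp add: algebra_simps diff_divide_distrib)
  qed
  \<comment> \<open>The factor in \<open>int_f\<close> is a difference quotient of \<open>t\<close>
    to the power \<open>- DIM('a)\<close> at 1, which is where the dimension in the claim comes
    from.\<close>
  have "((\<lambda>t. inverse t ^ DIM('a)) has_real_derivative - real DIM('a)) (at 1)"
    by (auto intro!: derivative_eq_intros)
  then have "((\<lambda>t. (inverse t ^ DIM('a) - 1) / (t - 1)) \<longlongrightarrow> - real DIM('a)) (at 1)"
    by (simp add: has_field_derivative_iff)
  from filterlim_compose[OF this s_lim]
  have "(\<lambda>n. (inverse (s n) ^ DIM('a) - 1) / (s n - 1) * (\<integral>x. H x \<partial>lborel))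
      \<longlonglongrightarrow> - real DIM('a) * (\<integral>x. H x \<partial>lborel)"
    by (intro tendsto_mult tendsto_const)
  then show ?thesis
    using lim1 LIMSEQ_unique unfolding int_f by blast
qed

section \<open>The hyperbolic volume measure\<close>

lemma hyp_spaceD:
  fixes x :: "'a::euclidean_space"
  assumes "x \<in> hyp_space"
  shows "norm x < 1" "(norm x)\<^sup>2 < 1"
  using assms by (auto simp: hyp_space_def power2_eq_square intro: mult_le_one
      le_less_trans[OF mult_left_le_one_le])

lemma sets_hyp_vol: "sets (hyp_vol :: 'a::euclidean_space measure) = sets (restrict_space borel hyp_space)"
  by (simp add: hyp_vol_def sets_restrict_space)

lemma space_hyp_vol [simp]: "space (hyp_vol :: 'a::euclidean_space measure) = hyp_space"
  by (simp add: hyp_vol_def space_restrict_space)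

lemma measurable_hyp_vol_borel:
  "f \<in> borel_measurable borel \<Longrightarrow> f \<in> borel_measurable (hyp_vol :: 'a::euclidean_space measure)"
  unfolding measurable_cong_sets[OF sets_hyp_vol refl] by (rule measurable_restrict_space1)

lemma measurable_hyp_vol_continuous:
  "continuous_on hyp_space f \<Longrightarrow> f \<in> borel_measurable (hyp_vol :: 'a::euclidean_space measure)"
  unfolding measurable_cong_sets[OF sets_hyp_vol refl] by (rule borel_measurable_continuous_on_restrict)

lemma hyp_space_borel [measurable]: "(hyp_space :: 'a::euclidean_space set) \<in> sets borel"
  by (simp add: hyp_space_def)

lemma hyp_vol_measurable_density:
  "(\<lambda>x::'a::euclidean_space. (2 / (1 - (norm x)\<^sup>2)) ^ DIM('a))
     \<in> borel_measurable (restrict_space lborel hyp_space)"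
  by (rule measurable_restrict_space1) measurable

lemma hyp_vol_density_nonneg:
  "AE x in restrict_space lborel hyp_space. 0 \<le> (2 / (1 - (norm (x::'a::euclidean_space))\<^sup>2)) ^ DIM('a)"
  by (rule AE_I2) (auto simp: space_restrict_space dest!: hyp_spaceD)

text \<open>The density is nonnegative on the ball. This is the passage to \<open>lborel\<close> on
  the whole space, where Euler's identity is available.\<close>

lemma integral_hyp_vol:
  fixes F :: "'a::euclidean_space \<Rightarrow> real"
  assumes "F \<in> borel_measurable hyp_vol"
  shows "(\<integral>x. F x \<partial>hyp_vol)
    = (\<integral>x. indicator hyp_space x * ((2 / (1 - (norm x)\<^sup>2)) ^ DIM('a) * F x) \<partial>lborel)"
    and "integrable hyp_vol F
    \<longleftrightarrow> integrable lborel (\<lambda>x. indicator hyp_space x * ((2 / (1 - (norm x)\<^sup>2)) ^ DIM('a) * F x))"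
proof -
  have F: "F \<in> borel_measurable (restrict_space lborel hyp_space)"
    using assms by (simp add: hyp_vol_def)
  show "(\<integral>x. F x \<partial>hyp_vol)
    = (\<integral>x. indicator hyp_space x * ((2 / (1 - (norm x)\<^sup>2)) ^ DIM('a) * F x) \<partial>lborel)"
    unfolding hyp_vol_def
    by (subst integral_density[OF F hyp_vol_measurable_density hyp_vol_density_nonneg])
       (subst integral_restrict_space, auto)
  show "integrable hyp_vol F
    \<longleftrightarrow> integrable lborel (\<lambda>x. indicator hyp_space x * ((2 / (1 - (norm x)\<^sup>2)) ^ DIM('a) * F x))"
    unfolding hyp_vol_def
    by (subst integrable_density[OF F hyp_vol_measurable_density hyp_vol_density_nonneg])
       (subst integrable_restrict_space, auto)
qed

text \<open>The density is strictly positive on the ball, so inside it the null sets are the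
  Lebesgue null sets.\<close>

lemma AE_hyp_vol:
  "(AE x in (hyp_vol :: 'a::euclidean_space measure). P x) \<longleftrightarrow> (AE x in lborel. x \<in> hyp_space \<longrightarrow> P x)"
proof -
  have "(AE x in (hyp_vol :: 'a measure). P x) \<longleftrightarrow> (AE x in restrict_space lborel hyp_space. P x)"
    unfolding hyp_vol_def
    by (subst AE_density, use hyp_vol_measurable_density in measurable, intro AE_cong)
       (auto simp: space_restrict_space dest: hyp_spaceD)
  then show ?thesis
    by (simp add: AE_restrict_space_iff)
qed

lemma AE_hyp_vol_nonzero: "AE x in (hyp_vol :: 'a::euclidean_space measure). x \<noteq> 0"
  unfolding AE_hyp_vol using AE_lborel_singleton[of "0::'a"] by auto

text \<open>On \<open>cball 0 R\<close> the density is at most its value at radius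
  \<open>R < 1\<close>, so this ball has finite volume. Boundedness is asked instead of continuity
  because the quotient \<open>hyp_rho x / norm x\<close> is 0 at the origin by the division
  convention, while its limit there is 2.\<close>

lemma integrable_hyp_vol_bounded:
  fixes F :: "'a::euclidean_space \<Rightarrow> real"
  assumes F: "F \<in> borel_measurable hyp_vol" and R: "R < 1"
    and bdd: "bounded (F ` cball 0 R)"
    and supp: "\<And>x. x \<in> hyp_space \<Longrightarrow> norm x > R \<Longrightarrow> F x = 0"
  shows "integrable hyp_vol F"
proof -
  obtain C where C: "\<And>x. norm x \<le> R \<Longrightarrow> \<bar>F x\<bar> \<le> C"
    using bdd unfolding bounded_iff by fastforce
  have fin: "emeasure (hyp_vol :: 'a measure) (cball 0 R) < \<infinity>"
  proof -
    have sub: "cball 0 R \<subseteq> (hyp_space :: 'a set)"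
      using R by (auto simp: hyp_space_def)
    have m: "cball 0 R \<in> sets (restrict_space lborel (hyp_space :: 'a set))"
      using sub by (auto simp: sets_restrict_space_iff)
    have "emeasure (hyp_vol :: 'a measure) (cball 0 R)
      = (\<integral>\<^sup>+x. ennreal ((2 / (1 - (norm x)\<^sup>2)) ^ DIM('a)) * indicator (cball 0 R) x
          \<partial>restrict_space lborel (hyp_space :: 'a set))"
      unfolding hyp_vol_def
      by (intro emeasure_density m measurable_compose[OF hyp_vol_measurable_density measurable_ennreal])
    also have "\<dots> \<le> (\<integral>\<^sup>+x. ennreal ((2 / (1 - R\<^sup>2)) ^ DIM('a)) * indicator (cball 0 R) x
          \<partial>restrict_space lborel (hyp_space :: 'a set))"
    proof (intro nn_integral_mono)
      fix x :: 'a
      show "ennreal ((2 / (1 - (norm x)\<^sup>2)) ^ DIM('a)) * indicator (cball 0 R) x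
        \<le> ennreal ((2 / (1 - R\<^sup>2)) ^ DIM('a)) * indicator (cball 0 R) x"
      proof (cases "norm x \<le> R")
        case True
        have "(norm x)\<^sup>2 \<le> R\<^sup>2" "R\<^sup>2 < 1"
          using True R order_trans[OF norm_ge_zero True] by (auto simp: power_mono abs_square_less_1)
        then have "(2 / (1 - (norm x)\<^sup>2)) ^ DIM('a) \<le> (2 / (1 - R\<^sup>2)) ^ DIM('a)"
          by (intro power_mono divide_left_mono) auto
        then show ?thesis
          by (intro mult_right_mono ennreal_leI) auto
      qed auto
    qed
    also have "\<dots> = ennreal ((2 / (1 - R\<^sup>2)) ^ DIM('a)) * emeasure lborel (cball (0::'a) R)"
      using m sub by (simp add: nn_integral_cmult_indicator emeasure_restrict_space)
    also have "\<dots> < \<infinity>"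
      using emeasure_lborel_cball_finite[of "0::'a" R] by (simp add: ennreal_mult_less_top)
    finally show ?thesis .
  qed
  show ?thesis
  proof (rule integrableI_bounded_set[where A = "cball 0 R" and B = C])
    show "cball 0 R \<in> sets (hyp_vol :: 'a measure)"
      using R unfolding sets_hyp_vol by (auto simp: sets_restrict_space_iff hyp_space_def)
    show "AE x in hyp_vol. x \<notin> cball 0 R \<longrightarrow> F x = 0"
      using supp by (intro AE_I2) auto
  qed (use F fin C in auto)
qed

lemma bounded_mult_comp:
  fixes f g :: "'a \<Rightarrow> real"
  assumes "bounded (f ` S)" "bounded (g ` S)"
  shows "bounded ((\<lambda>x. f x * g x) ` S)"
proof -
  obtain B C where "\<And>x. x \<in> S \<Longrightarrow> \<bar>f x\<bar> \<le> B" "\<And>x. x \<in> S \<Longrightarrow> \<bar>g x\<bar> \<le> C"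
    using assms unfolding bounded_iff by auto
  then have "\<bar>f x * g x\<bar> \<le> B * C" if "x \<in> S" for x
    using that mult_mono'[of "\<bar>f x\<bar>" B "\<bar>g x\<bar>" C] by (simp add: abs_mult)
  then show ?thesis
    unfolding bounded_iff by auto
qed

lemma bounded_continuous_on_hyp_space:
  fixes f :: "'a::euclidean_space \<Rightarrow> 'b::real_normed_vector"
  assumes "continuous_on hyp_space f" "R < 1"
  shows "bounded (f ` cball 0 R)"
  using assms by (intro compact_imp_bounded compact_continuous_image)
    (auto simp: hyp_space_def intro: continuous_on_subset)

section \<open>Gradients and test functions\<close>

lemma euclidean_gradI:
  assumes "GDERIV f x :> D"
  shows "euclidean_grad f x = D"
  unfolding euclidean_grad_def
proof (rule the_equality)
  show "GDERIV f x :> D"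
    by (rule assms)
next
  fix D'
  assume "GDERIV f x :> D'"
  with assms have "(\<lambda>h. h \<bullet> D') = (\<lambda>h. h \<bullet> D)"
    unfolding gderiv_def by (rule has_derivative_unique[rotated])
  then have "(D' - D) \<bullet> (D' - D) = 0"
    by (simp add: fun_eq_iff inner_diff_right)
  then show "D' = D"
    by simp
qed

text \<open>Riesz representation in the orthonormal basis. The explicit sum reduces continuity of
  the gradient to that of the partial derivatives.\<close>

lemma differentiable_imp_gderiv:
  fixes f :: "'a::euclidean_space \<Rightarrow> real"
  assumes "f differentiable at x"
  shows "GDERIV f x :> (\<Sum>b\<in>Basis. frechet_derivative f (at x) b *\<^sub>R b)"
proof -
  let ?D = "frechet_derivative f (at x)"
  have D: "(f has_derivative ?D) (at x)"
    using assms by (simp add: frechet_derivative_works)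
  then have "linear ?D"
    by (rule has_derivative_linear)
  then have "?D h = h \<bullet> (\<Sum>b\<in>Basis. ?D b *\<^sub>R b)" for h
    using Linear_Algebra.linear_componentwise[of ?D h 1] by (simp add: inner_sum_right mult.commute)
  then have "?D = (\<lambda>h. h \<bullet> (\<Sum>b\<in>Basis. ?D b *\<^sub>R b))"
    by (rule ext)
  with D show ?thesis
    unfolding gderiv_def by (rule has_derivative_eq_rhs)
qed

lemma test_function_differentiable:
  fixes u :: "'a::euclidean_space \<Rightarrow> real"
  assumes "test_function_on S u"
  shows "x \<in> S \<Longrightarrow> u differentiable at x"
    and "continuous_on S (\<lambda>x. frechet_derivative u (at x) v)"
proof -
  have "Ck_on (Suc 0) S u"
    using assms unfolding test_function_on_def smooth_on_def by blast
  then show "x \<in> S \<Longrightarrow> u differentiable at x"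
    and "continuous_on S (\<lambda>x. frechet_derivative u (at x) v)"
    by auto
qed

lemma test_function_gderiv:
  fixes u :: "'a::euclidean_space \<Rightarrow> real"
  assumes "test_function_on S u" "x \<in> S"
  shows "GDERIV u x :> euclidean_grad u x"
proof -
  note D = differentiable_imp_gderiv[OF test_function_differentiable(1)[OF assms]]
  show ?thesis
    by (subst euclidean_gradI[OF D]) (rule D)
qed

lemma test_function_continuous:
  fixes u :: "'a::euclidean_space \<Rightarrow> real"
  assumes "test_function_on S u"
  shows "continuous_on S u"
  using assms unfolding test_function_on_def smooth_on_def by (metis Ck_on.simps(1))

lemma test_function_continuous_grad:
  fixes u :: "'a::euclidean_space \<Rightarrow> real"
  assumes "test_function_on S u"
  shows "continuous_on S (euclidean_grad u)"
proof -
  have "continuous_on S (\<lambda>x. \<Sum>b\<in>Basis. frechet_derivative u (at x) b *\<^sub>R b)"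
    by (intro continuous_intros test_function_differentiable(2)[OF assms])
  moreover have "(\<Sum>b\<in>Basis. frechet_derivative u (at x) b *\<^sub>R b) = euclidean_grad u x"
    if "x \<in> S" for x
    by (rule euclidean_gradI[OF differentiable_imp_gderiv[OF test_function_differentiable(1)[OF assms that]],
          symmetric])
  ultimately show ?thesis
    by (rule continuous_on_eq)
qed

text \<open>On the compact support the norm attains its maximum, which is below 1 because the
  support lies in the open ball. Beyond that radius \<open>u\<close> vanishes on an open set, hence
  so does its gradient.\<close>

lemma test_function_support_radius:
  fixes u :: "'a::euclidean_space \<Rightarrow> real"
  assumes "test_function_on hyp_space u"
  obtains R where "R < 1"
    "\<And>x. x \<in> hyp_space \<Longrightarrow> norm x > R \<Longrightarrow> u x = 0"
    "\<And>x. x \<in> hyp_space \<Longrightarrow> norm x > R \<Longrightarrow> euclidean_grad u x = 0"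
proof -
  define K where "K = hyp_space \<inter> closure {x \<in> hyp_space. u x \<noteq> 0}"
  have "compact K"
    using assms by (simp add: K_def test_function_on_def)
  have in_K: "x \<in> K" if "x \<in> hyp_space" "u x \<noteq> 0" for x
    unfolding K_def using that by (intro IntI subsetD[OF closure_subset]) auto
  obtain R where R: "R < 1" "\<And>x. x \<in> K \<Longrightarrow> norm x \<le> R"
  proof (cases "K = {}")
    case True
    then show ?thesis
      using that[of 0] by simp
  next
    case False
    have "\<exists>y\<in>K. \<forall>x\<in>K. norm x \<le> norm y"
      by (rule continuous_attains_sup[OF \<open>compact K\<close> False]) (rule continuous_on_norm_id)
    then obtain y where y: "y \<in> K" "\<forall>x\<in>K. norm x \<le> norm y" ..
    from y(1) have "norm y < 1"
      by (simp add: K_def hyp_space_def)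
    with y(2) show ?thesis
      using that[of "norm y"] by simp
  qed
  have zero: "u x = 0" if "x \<in> hyp_space" "norm x > R" for x
    using in_K[OF that(1)] R(2)[of x] that(2) by linarith
  have zero_grad: "euclidean_grad u x = 0" if "x \<in> hyp_space" "norm x > R" for x
  proof (rule euclidean_gradI)
    have "open (hyp_space \<inter> {x::'a. norm x > R})"
      unfolding hyp_space_def by (intro open_Int open_ball open_Collect_less continuous_intros)
    then show "GDERIV u x :> 0"
      unfolding gderiv_def inner_zero_right
      by (rule has_derivative_transform_within_open[OF has_derivative_const]) (use that zero in auto)
  qed
  show ?thesis
    by (rule that[OF R(1) zero zero_grad])
qed

text \<open>By continuity the set where \<open>u\<close> does not vanish is open, and a nonempty
  open set is not negligible. This excludes zero integrals in the main proof.\<close>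

lemma test_function_not_AE_zero:
  fixes u :: "'a::euclidean_space \<Rightarrow> real"
  assumes u: "test_function_on hyp_space u" and ne: "\<exists>x\<in>hyp_space. u x \<noteq> 0"
  shows "\<not> (AE x in hyp_vol. u x = 0)"
proof
  define U where "U = {x \<in> hyp_space. u x \<noteq> 0}"
  assume "AE x in hyp_vol. u x = 0"
  then have "AE x in lborel. x \<notin> U"
    unfolding AE_hyp_vol U_def by auto
  moreover have "open U"
    using continuous_open_preimage[OF test_function_continuous[OF u] _ open_Compl[OF closed_singleton[of 0]]]
    by (simp add: U_def hyp_space_def vimage_def Int_def)
  ultimately have "U \<in> null_sets lborel"
    by (subst AE_iff_null_sets) auto
  then have "negligible U"
    unfolding negligible_iff_null_sets by (rule null_sets_completionI)
  with open_not_negligible[OF \<open>open U\<close>] have "U = {}"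
    by auto
  with ne show False
    by (simp add: U_def)
qed

section \<open>The conformal factor and the distance from the origin\<close>

text \<open>The hyperbolic metric is the square of this factor times the Euclidean one, and the
  volume density is its power \<open>DIM('a)\<close>.\<close>

definition conformal_factor :: "'a::euclidean_space \<Rightarrow> real" where
  "conformal_factor x = 2 / (1 - (norm x)\<^sup>2)"

lemma conformal_factor_pos: "x \<in> hyp_space \<Longrightarrow> conformal_factor x > 0"
  by (simp add: conformal_factor_def hyp_spaceD)

text \<open>The metric contributes the factor squared and the two gradients contribute its power -4,
  which leaves the power -2.\<close>

lemma hyp_norm_grad:
  assumes "x \<in> hyp_space"
  shows "(hyp_norm x (hyp_grad f x))\<^sup>2 = (euclidean_grad f x \<bullet> euclidean_grad f x) / (conformal_factor x)\<^sup>2"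
proof -
  have "hyp_grad f x = (1 / (conformal_factor x)\<^sup>2) *\<^sub>R euclidean_grad f x"
    by (simp add: hyp_grad_def conformal_factor_def power_divide)
  then have "hyp_metric x (hyp_grad f x) (hyp_grad f x)
      = (euclidean_grad f x \<bullet> euclidean_grad f x) / (conformal_factor x)\<^sup>2"
    using conformal_factor_pos[OF assms]
    by (simp add: hyp_metric_def flip: conformal_factor_def) (simp add: power2_eq_square power4_eq_xxxx)
  then show ?thesis
    by (simp add: hyp_norm_def)
qed

lemma exp_hyp_rho:
  assumes "x \<in> hyp_space"
  shows "exp (hyp_rho x) = (1 + norm x) / (1 - norm x)"
  using hyp_spaceD[OF assms] by (simp add: hyp_rho_def add_pos_nonneg)

lemma cosh_hyp_rho:
  assumes "x \<in> hyp_space"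
  shows "cosh (hyp_rho x) = conformal_factor x * (1 + (norm x)\<^sup>2) / 2"
proof -
  have "1 + norm x > 0" "1 - norm x > 0"
    using hyp_spaceD[OF assms] by (auto simp: add_pos_nonneg)
  moreover have "1 - (norm x)\<^sup>2 = (1 + norm x) * (1 - norm x)"
    by (simp add: power2_eq_square algebra_simps)
  ultimately show ?thesis
    by (simp add: cosh_field_def exp_minus exp_hyp_rho[OF assms] conformal_factor_def divide_simps)
       (simp add: power2_eq_square algebra_simps)
qed

lemma sinh_hyp_rho:
  assumes "x \<in> hyp_space"
  shows "sinh (hyp_rho x) = conformal_factor x * norm x"
proof -
  have "1 + norm x > 0" "1 - norm x > 0"
    using hyp_spaceD[OF assms] by (auto simp: add_pos_nonneg)
  moreover have "1 - (norm x)\<^sup>2 = (1 + norm x) * (1 - norm x)"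
    by (simp add: power2_eq_square algebra_simps)
  ultimately show ?thesis
    by (simp add: sinh_field_def exp_minus exp_hyp_rho[OF assms] conformal_factor_def divide_simps)
       (simp add: power2_eq_square algebra_simps)
qed

text \<open>The upper bound is \<open>ln y \<le> y - 1\<close>. It vanishes linearly at the origin,
  which is what keeps \<open>hyp_rho x / norm x\<close> bounded.\<close>

lemma hyp_rho_bounds:
  assumes "x \<in> hyp_space"
  shows "0 \<le> hyp_rho x" "hyp_rho x \<le> 2 * norm x / (1 - norm x)"
proof -
  have n: "1 - norm x > 0"
    using hyp_spaceD[OF assms] by auto
  then show "0 \<le> hyp_rho x"
    by (simp add: hyp_rho_def)
  have "hyp_rho x \<le> (1 + norm x) / (1 - norm x) - 1"
    unfolding hyp_rho_def using n by (intro ln_le_minus_one divide_pos_pos add_pos_nonneg) auto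
  also have "\<dots> = 2 * norm x / (1 - norm x)"
    using n by (simp add: field_simps)
  finally show "hyp_rho x \<le> 2 * norm x / (1 - norm x)" .
qed

lemma hyp_rho_eq_0_iff:
  assumes "x \<in> hyp_space"
  shows "hyp_rho x = 0 \<longleftrightarrow> x = 0"
proof -
  have "sinh (hyp_rho x) = 0 \<longleftrightarrow> x = 0"
    using conformal_factor_pos[OF assms] by (simp add: sinh_hyp_rho[OF assms])
  then show ?thesis
    by (simp add: sinh_zero_iff)
qed

lemma continuous_on_conformal_factor: "continuous_on hyp_space conformal_factor"
  unfolding conformal_factor_def by (intro continuous_intros) (auto dest: hyp_spaceD)

lemma continuous_on_hyp_rho: "continuous_on hyp_space hyp_rho"
proof -
  have "1 + norm x > 0" "1 - norm x > 0" if "x \<in> hyp_space" for x :: 'a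
    using hyp_spaceD[OF that] by (auto simp: add_pos_nonneg)
  then show ?thesis
    unfolding hyp_rho_def by (intro continuous_intros) (auto simp: less_imp_neq[symmetric])
qed

lemma borel_measurable_hyp [measurable]:
  "hyp_rho \<in> borel_measurable borel" "conformal_factor \<in> borel_measurable borel"
  unfolding hyp_rho_def[abs_def] conformal_factor_def[abs_def] by measurable

lemma bounded_hyp_rho_div_norm:
  fixes R :: real
  assumes "R < 1"
  shows "bounded ((\<lambda>x::'a::euclidean_space. hyp_rho x / norm x) ` cball 0 R)"
  unfolding bounded_iff
proof (intro exI ballI, elim imageE, simp del: abs_divide)
  fix x :: 'a
  assume "norm x \<le> R"
  show "\<bar>hyp_rho x / norm x\<bar> \<le> 2 / (1 - R)"
  proof (cases "x = 0")
    case False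
    have x: "x \<in> hyp_space"
      using \<open>norm x \<le> R\<close> assms by (simp add: hyp_space_def)
    have "hyp_rho x / norm x \<le> 2 / (1 - norm x)"
      using hyp_rho_bounds(2)[OF x] False by (simp add: pos_divide_le_eq mult.commute)
    also have "\<dots> \<le> 2 / (1 - R)"
      using \<open>norm x \<le> R\<close> assms by (intro divide_left_mono) auto
    finally show ?thesis
      using hyp_rho_bounds(1)[OF x] by simp
  qed (use assms in simp)
qed

text \<open>The profile \<open>ln ((1 + t) / (1 - t))\<close> has derivative
  \<open>2 / (1 - t\<^sup>2)\<close>, the conformal factor itself. In Euclidean terms this says that
  the Riemannian gradient of the distance has norm 1.\<close>

lemma gderiv_hyp_rho:
  assumes "x \<in> hyp_space" "x \<noteq> 0"
  shows "GDERIV hyp_rho x :> conformal_factor x *\<^sub>R sgn x"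
proof -
  let ?t = "norm x"
  have t: "0 < 1 + ?t" "0 < 1 - ?t"
    using hyp_spaceD[OF assms(1)] by (auto simp: add_pos_nonneg)
  have "1 - ?t\<^sup>2 = (1 + ?t) * (1 - ?t)"
    by (simp add: power2_eq_square algebra_simps)
  with t have "((\<lambda>t. ln ((1 + t) / (1 - t))) has_real_derivative conformal_factor x) (at ?t)"
    by (auto intro!: derivative_eq_intros simp: conformal_factor_def divide_simps)
  from GDERIV_DERIV_compose[OF GDERIV_norm[OF assms(2)] this]
  show ?thesis
    by (simp add: hyp_rho_def[abs_def])
qed

lemma gderiv_conformal_factor:
  assumes "x \<in> hyp_space" "x \<noteq> 0"
  shows "GDERIV conformal_factor x :> ((conformal_factor x)\<^sup>2 * norm x) *\<^sub>R sgn x"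
proof -
  let ?t = "norm x"
  have "1 - ?t\<^sup>2 > 0"
    using hyp_spaceD[OF assms(1)] by simp
  then have "((\<lambda>t. 2 / (1 - t\<^sup>2)) has_real_derivative (conformal_factor x)\<^sup>2 * ?t) (at ?t)"
    by (auto intro!: derivative_eq_intros simp: conformal_factor_def divide_simps)
       (simp add: power2_eq_square)
  from GDERIV_DERIV_compose[OF GDERIV_norm[OF assms(2)] this]
  show ?thesis
    by (simp add: conformal_factor_def[abs_def])
qed

section \<open>Partial integration along the radial field\<close>

text \<open>Away from the origin this is the divergence of \<open>\<rho> \<nabla>\<rho>\<close>,
  namely \<open>1 + (N - 1) \<rho> coth \<rho>\<close> with \<open>coth \<rho>\<close> written as
  \<open>(1 + r\<^sup>2) / (2 r)\<close> for \<open>r = norm x\<close>. At the origin the division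
  convention gives 1 instead of the limit \<open>N\<close>.\<close>

definition radial_kernel :: "'a::euclidean_space \<Rightarrow> real" where
  "radial_kernel x = 1 + (real DIM('a) - 1) * (hyp_rho x / norm x) * (1 + (norm x)\<^sup>2) / 2"

lemma radial_kernel_pos: "x \<in> hyp_space \<Longrightarrow> radial_kernel x > 0"
  unfolding radial_kernel_def using hyp_rho_bounds(1)[of x] DIM_positive[where 'a = 'a]
  by (intro add_pos_nonneg divide_nonneg_nonneg mult_nonneg_nonneg) (auto simp: Suc_le_eq)

text \<open>The fraction is \<open>\<rho> coth \<rho> - 1\<close>, so the left side is
  \<open>1 + (N - 1) \<rho> coth \<rho>\<close>. At the origin the conventions give \<open>N\<close>
  on the left and 1 on the right, whence \<open>x \<noteq> 0\<close>.\<close>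

lemma radial_kernel_eq:
  fixes x :: "'a::euclidean_space"
  assumes "x \<in> hyp_space" "x \<noteq> 0"
  shows "real DIM('a) + (real DIM('a) - 1) *
      ((hyp_rho x * cosh (hyp_rho x) - sinh (hyp_rho x)) / sinh (hyp_rho x)) = radial_kernel x"
  using conformal_factor_pos[OF assms(1)] assms(2)
  unfolding radial_kernel_def cosh_hyp_rho[OF assms(1)] sinh_hyp_rho[OF assms(1)]
  by (simp add: field_simps)

text \<open>The left side is \<open>r\<close> times the radial derivative of
  \<open>(\<rho> / r) * p ^ n\<close> under the rules \<open>\<rho>' = p\<close> and
  \<open>p' = p\<^sup>2 * r\<close>. The right side, with \<open>Suc n\<close> as dimension,
  isolates the kernel; the remaining term cancels against Euler's identity.\<close>

lemma radial_identity:
  fixes p r \<rho> :: real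
  assumes r: "r \<noteq> 0" and p: "p * (1 - r\<^sup>2) = 2"
  shows "r * (\<rho> * inverse r * (real n * p ^ (n - Suc 0) * (p\<^sup>2 * r))
      + p ^ n * (\<rho> * - (inverse r)\<^sup>2 + inverse r * p))
    = p ^ Suc n * (1 + real n * (\<rho> / r) * (1 + r\<^sup>2) / 2 - real (Suc n) * (\<rho> / r) / p)"
proof -
  define q where "q = \<rho> / r"
  have \<rho>: "\<rho> = q * r" and "p \<noteq> 0"
    using assms by (auto simp: q_def)
  \<comment> \<open>The truncated exponent \<open>n - Suc 0\<close> is harmless for
    \<open>n = 0\<close>, since the factor \<open>real n\<close> is then 0.\<close>
  have n: "real n * p ^ (n - Suc 0) * (p\<^sup>2 * r) = real n * p ^ n * p * r"
    by (cases n) (auto simp: power2_eq_square)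
  have half: "p * (1 + r\<^sup>2) / 2 = 1 + r\<^sup>2 * p"
    using p by (simp add: algebra_simps)
  have "r * (\<rho> * inverse r * (real n * p ^ (n - Suc 0) * (p\<^sup>2 * r))
      + p ^ n * (\<rho> * - (inverse r)\<^sup>2 + inverse r * p))
    = p ^ n * (p + real n * q * (r\<^sup>2 * p) - q)"
    unfolding n unfolding \<rho> using r by (simp add: field_simps power2_eq_square)
  \<comment> \<open>Replacing \<open>r\<^sup>2 * p\<close> by
    \<open>p * (1 + r\<^sup>2) / 2 - 1\<close> raises the coefficient of \<open>q\<close> from 1 to
    \<open>Suc n\<close>.\<close>
  also have "\<dots> = p ^ n * (p + real n * q * (p * (1 + r\<^sup>2) / 2) - real (Suc n) * q)"
    unfolding half by (simp add: algebra_simps)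
  also have "\<dots> = p ^ Suc n * (1 + real n * q * (1 + r\<^sup>2) / 2 - real (Suc n) * q / p)"
    using \<open>p \<noteq> 0\<close> by (simp add: field_simps)
  finally show ?thesis
    by (simp add: q_def)
qed

text \<open>Product and chain rule. The result keeps the shape that these rules produce, and
  \<open>radial_identity\<close> simplifies it later.\<close>

lemma gderiv_radial_weight:
  fixes x :: "'a::euclidean_space"
  assumes x: "x \<in> hyp_space" "x \<noteq> 0"
  defines "r \<equiv> norm x" and "p \<equiv> conformal_factor x" and "\<rho> \<equiv> hyp_rho x"
  shows "GDERIV (\<lambda>y. hyp_rho y * inverse (norm y) * conformal_factor y ^ n) x :>
    (\<rho> * inverse r * (real n * p ^ (n - Suc 0) * (p\<^sup>2 * r))
      + p ^ n * (\<rho> * - (inverse r)\<^sup>2 + inverse r * p)) *\<^sub>R sgn x"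
  unfolding assms
  by (rule GDERIV_subst, rule GDERIV_mult, rule GDERIV_mult, rule gderiv_hyp_rho[OF x],
      rule GDERIV_inverse, rule GDERIV_norm[OF x(2)])
     (use x in \<open>auto intro!: GDERIV_DERIV_compose[OF gderiv_conformal_factor[OF x] DERIV_pow]
        simp: algebra_simps\<close>)

text \<open>Here \<open>cross\<close> is \<open>2 u \<rho>\<close> times the hyperbolic inner
  product of \<open>\<nabla>u\<close> and \<open>\<nabla>\<rho>\<close>: the Euclidean gradient of
  \<open>\<rho>\<close> has length \<open>p\<close>, and the metric contributes \<open>p\<close> to
  the power -2. Compact support removes the boundary term.\<close>

lemma integral_radial_by_parts:
  fixes u :: "'a::euclidean_space \<Rightarrow> real"
  assumes u: "test_function_on hyp_space u"
  defines "cross \<equiv> \<lambda>x. 2 * u x * (hyp_rho x / norm x) * (x \<bullet> euclidean_grad u x) / conformal_factor x"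
  shows "integrable hyp_vol cross"
    and "integrable hyp_vol (\<lambda>x. radial_kernel x * (u x)\<^sup>2)"
    and "(\<integral>x. cross x \<partial>hyp_vol) = - (\<integral>x. radial_kernel x * (u x)\<^sup>2 \<partial>hyp_vol)"
proof -
  \<comment> \<open>One of the \<open>DIM('a)\<close> factors of the volume density is absorbed by
    the division in \<open>h\<close>, so the power \<open>n\<close> remains.\<close>
  define n where "n = DIM('a) - 1"
  have N: "DIM('a) = Suc n"
    using DIM_positive[where 'a = 'a] by (simp add: n_def)
  define h where "h x = hyp_rho x / norm x * (u x)\<^sup>2 / conformal_factor x" for x
  define kernel where "kernel x = radial_kernel x * (u x)\<^sup>2" for x
  \<comment> \<open>Off the origin \<open>F\<close> will turn out to be
    \<open>x \<bullet> G x\<close>, the radial derivative that enters Euler's identity.\<close>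
  define F where "F x = conformal_factor x ^ DIM('a) * (cross x + kernel x - real DIM('a) * h x)" for x
  obtain R where R: "R < 1"
    and u0: "\<And>x. x \<in> hyp_space \<Longrightarrow> norm x > R \<Longrightarrow> u x = 0"
    by (rule test_function_support_radius[OF u]) (rule that)
  note cont = test_function_continuous[OF u] test_function_continuous_grad[OF u]
  have [measurable]: "u \<in> borel_measurable hyp_vol" "euclidean_grad u \<in> borel_measurable hyp_vol"
    "(hyp_rho :: 'a \<Rightarrow> real) \<in> borel_measurable hyp_vol"
    "(conformal_factor :: 'a \<Rightarrow> real) \<in> borel_measurable hyp_vol"
    "(\<lambda>x::'a. norm x) \<in> borel_measurable hyp_vol"
    "(\<lambda>x::'a. x) \<in> borel_measurable hyp_vol"
    using cont by (auto intro: measurable_hyp_vol_continuous measurable_hyp_vol_borel)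
  have meas [measurable]: "cross \<in> borel_measurable hyp_vol" "kernel \<in> borel_measurable hyp_vol"
    "h \<in> borel_measurable hyp_vol"
    unfolding cross_def kernel_def[abs_def] h_def[abs_def] radial_kernel_def by measurable
  have inverse_cont: "continuous_on hyp_space (\<lambda>x::'a. inverse (conformal_factor x))"
    by (intro continuous_intros continuous_on_conformal_factor)
       (auto dest: conformal_factor_pos)
  have bdd_cross: "bounded (cross ` cball 0 R)"
    unfolding cross_def divide_inverse[of _ "conformal_factor _"]
    by (intro bounded_mult_comp bounded_hyp_rho_div_norm R
        bounded_continuous_on_hyp_space[OF inverse_cont R] bounded_continuous_on_hyp_space[OF _ R]
        continuous_intros cont)
  have bdd_kernel: "bounded (kernel ` cball 0 R)"
    unfolding kernel_def[abs_def] radial_kernel_def divide_inverse[of _ 2]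
    by (intro bounded_mult_comp bounded_plus_comp bounded_hyp_rho_div_norm R
        bounded_continuous_on_hyp_space[OF _ R] continuous_intros cont)
  have bdd_h: "bounded (h ` cball 0 R)"
    unfolding h_def[abs_def] divide_inverse[of _ "conformal_factor _"]
    by (intro bounded_mult_comp bounded_hyp_rho_div_norm R
        bounded_continuous_on_hyp_space[OF inverse_cont R] bounded_continuous_on_hyp_space[OF _ R]
        continuous_intros cont)
  have bdd_F: "bounded (F ` cball 0 R)"
    unfolding F_def[abs_def]
    by (intro bounded_mult_comp bounded_plus_comp bounded_minus_comp bdd_cross bdd_kernel bdd_h)
       (intro bounded_continuous_on_hyp_space[OF _ R] continuous_intros continuous_on_conformal_factor)+
  then obtain M where M: "\<And>x. x \<in> cball 0 R \<Longrightarrow> \<bar>F x\<bar> \<le> M"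
    unfolding bounded_iff by fastforce
  have zero: "cross x = 0" "kernel x = 0" "h x = 0" if "x \<in> hyp_space" "norm x > R" for x
    using u0[OF that] by (auto simp: cross_def kernel_def h_def)
  have int: "integrable hyp_vol cross" "integrable hyp_vol kernel" "integrable hyp_vol h"
    using zero by (auto intro: integrable_hyp_vol_bounded R meas bdd_cross bdd_kernel bdd_h)

  \<comment> \<open>The radial weight \<open>W\<close> satisfies \<open>H = W u\<^sup>2\<close> on
    the ball, and \<open>w\<close> is its radial derivative. Both \<open>H\<close> and
    \<open>G\<close> are extended by 0 to the whole space.\<close>
  define W where "W y = hyp_rho y * inverse (norm y) * conformal_factor y ^ n" for y :: 'a
  define w where "w x = hyp_rho x * inverse (norm x)
      * (real n * conformal_factor x ^ (n - Suc 0) * ((conformal_factor x)\<^sup>2 * norm x))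
    + conformal_factor x ^ n
      * (hyp_rho x * - (inverse (norm x))\<^sup>2 + inverse (norm x) * conformal_factor x)" for x :: 'a
  define H where "H x = indicator hyp_space x * (conformal_factor x ^ DIM('a) * h x)" for x
  define G where "G x = (if x \<in> hyp_space then (2 * W x * u x) *\<^sub>R euclidean_grad u x
    + ((u x)\<^sup>2 * w x) *\<^sub>R sgn x else 0)" for x
  have H_eq: "H x = W x * (u x)\<^sup>2" if "x \<in> hyp_space" for x
    using conformal_factor_pos[OF that] that by (simp add: H_def h_def W_def N divide_inverse)
  have H0: "H x = 0" if "norm x > R" for x
    using that u0[of x] by (auto simp: H_def h_def indicator_def)
  have deriv: "GDERIV H x :> G x" if "x \<noteq> 0" for x
  proof (cases "x \<in> hyp_space")
    case True
    have "GDERIV (\<lambda>y. W y * (u y * u y)) x :> G x"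
      unfolding W_def using True
      by (intro GDERIV_subst[OF GDERIV_mult[OF gderiv_radial_weight[OF True that]
              GDERIV_mult[OF test_function_gderiv[OF u True] test_function_gderiv[OF u True]]]])
         (simp add: G_def W_def w_def power2_eq_square scaleR_add_left[symmetric] scaleR_add_right mult_ac)
    then show ?thesis
      unfolding gderiv_def
      by (rule has_derivative_transform_within_open[where s = hyp_space])
         (use True H_eq in \<open>auto simp: hyp_space_def power2_eq_square\<close>)
  next
    case False
    \<comment> \<open>Points on the unit sphere are covered as well: because \<open>R < 1\<close>
      they lie in this open set, on which \<open>H\<close> vanishes.\<close>
    have "open {y::'a. norm y > R}"
      by (intro open_Collect_less continuous_intros)
    moreover have "norm x > R"
      using False R by (simp add: hyp_space_def)
    ultimately have "GDERIV H x :> 0"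
      unfolding gderiv_def inner_zero_right
      by (intro has_derivative_transform_within_open[OF has_derivative_const]) (use H0 in auto)
    with False show ?thesis
      by (simp add: G_def)
  qed
  have xG: "x \<bullet> G x = F x" if "x \<in> hyp_space" "x \<noteq> 0" for x
  proof -
    have p: "conformal_factor x * (1 - (norm x)\<^sup>2) = 2" "conformal_factor x > 0"
      using hyp_spaceD(2)[OF that(1)] conformal_factor_pos[OF that(1)]
      by (simp_all add: conformal_factor_def del: right_diff_distrib_numeral)
    have "x \<bullet> sgn x = norm x"
      using that by (simp add: sgn_div_norm dot_square_norm power2_eq_square)
    then have "x \<bullet> G x = 2 * W x * u x * (x \<bullet> euclidean_grad u x) + (u x)\<^sup>2 * (norm x * w x)"
      using that by (simp add: G_def inner_add_right)
    also have "norm x * w x = conformal_factor x ^ Suc n *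
      (1 + real n * (hyp_rho x / norm x) * (1 + (norm x)\<^sup>2) / 2
        - real (Suc n) * (hyp_rho x / norm x) / conformal_factor x)"
      unfolding w_def using that p by (intro radial_identity) auto
    also have "2 * W x * u x * (x \<bullet> euclidean_grad u x) = conformal_factor x ^ Suc n * cross x"
      using p by (simp add: W_def cross_def divide_inverse)
    finally show ?thesis
      unfolding F_def kernel_def h_def radial_kernel_def N by (simp add: algebra_simps)
  qed
  \<comment> \<open>At the origin the left side is 0 while \<open>F\<close> need not be; the
    indicator removes this single null point.\<close>
  have xG_eq: "x \<bullet> G x = indicator (- {0}) x * (indicator hyp_space x * F x)" for x
    using xG[of x] by (auto simp: indicator_def G_def)
  have F0: "F x = 0" if "x \<in> hyp_space" "norm x > R" for x
    using zero[OF that] by (simp add: F_def)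
  have lborel_F: "(\<integral>x. indicator hyp_space x * F x \<partial>lborel)
      = (\<integral>x. cross x + kernel x - real DIM('a) * h x \<partial>hyp_vol)"
    using integral_hyp_vol(1)[of "\<lambda>x. cross x + kernel x - real DIM('a) * h x"]
    by (simp add: F_def[abs_def] conformal_factor_def)
  \<comment> \<open>Measurability on the whole space is read off from integrability transferred to
    \<open>lborel\<close>.\<close>
  have [measurable]: "(\<lambda>x. indicator hyp_space x * F x) \<in> borel_measurable borel"
  proof -
    have "integrable hyp_vol (\<lambda>x. cross x + kernel x - real DIM('a) * h x)"
      using int by simp
    then show ?thesis
      by (subst (asm) integral_hyp_vol(2))
         (auto simp: F_def[abs_def] conformal_factor_def dest: borel_measurable_integrable)
  qed
  have "integrable lborel H" and lborel_H: "(\<integral>x. H x \<partial>lborel) = (\<integral>x. h x \<partial>hyp_vol)"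
    using integral_hyp_vol[of h] int(3) by (auto simp: H_def[abs_def] conformal_factor_def)
  have "(\<integral>x. x \<bullet> G x \<partial>lborel) = - real DIM('a) * (\<integral>x. H x \<partial>lborel)"
  proof (rule integral_inner_gderiv)
    show "integrable lborel H"
      by fact
    show "(\<lambda>x. x \<bullet> G x) \<in> borel_measurable borel"
      unfolding xG_eq by measurable
    \<comment> \<open>\<open>M\<close> bounds \<open>F\<close> on \<open>cball 0 R\<close> and could
      be negative if that ball is empty; elsewhere the value is 0.\<close>
    show "\<bar>x \<bullet> G x\<bar> \<le> max M 0" for x
      using M[of x] F0[of x] unfolding xG_eq by (cases "norm x \<le> R") (auto simp: indicator_def)
  qed (use deriv H0 in auto)
  moreover have "(\<integral>x. x \<bullet> G x \<partial>lborel) = (\<integral>x. indicator hyp_space x * F x \<partial>lborel)"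
  proof (rule integral_cong_AE)
    show "AE x in lborel. x \<bullet> G x = indicator hyp_space x * F x"
      using AE_lborel_singleton[of "0::'a"] by (auto simp: xG_eq)
  qed (auto simp: xG_eq)
  \<comment> \<open>The term with \<open>h\<close> inside \<open>F\<close> cancels the right side of
    Euler's identity.\<close>
  ultimately have "(\<integral>x. cross x \<partial>hyp_vol) = - (\<integral>x. kernel x \<partial>hyp_vol)"
    using int by (simp add: lborel_F lborel_H)
  with int show "integrable hyp_vol cross"
    and "integrable hyp_vol (\<lambda>x. radial_kernel x * (u x)\<^sup>2)"
    and "(\<integral>x. cross x \<partial>hyp_vol) = - (\<integral>x. radial_kernel x * (u x)\<^sup>2 \<partial>hyp_vol)"
    by (simp_all add: kernel_def[abs_def])
qed

section \<open>Expansion of the weighted gradient and conclusion\<close>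

text \<open>The origin is a null set. Discarding one point, instead of comparing almost everywhere,
  avoids measurability conditions on the integrands.\<close>

lemma integral_hyp_vol_cong:
  fixes f g :: "'a::euclidean_space \<Rightarrow> real"
  assumes "\<And>x. x \<in> hyp_space \<Longrightarrow> x \<noteq> 0 \<Longrightarrow> f x = g x"
  shows "(\<integral>x. f x \<partial>hyp_vol) = (\<integral>x. g x \<partial>hyp_vol)"
proof (rule integral_discrete_difference[where X = "{0}"])
  have sets: "{0::'a} \<in> sets hyp_vol"
    unfolding sets_hyp_vol by (auto simp: sets_restrict_space_iff hyp_space_def)
  have "{0::'a} \<in> null_sets hyp_vol"
    using AE_hyp_vol_nonzero by (subst AE_iff_null_sets[OF sets]) simp
  with sets show "x \<in> {0} \<Longrightarrow> emeasure hyp_vol {x} = 0" "x \<in> {0} \<Longrightarrow> {x} \<in> sets hyp_vol" for x :: 'a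
    by auto
qed (use assms in auto)

text \<open>With \<open>E\<close> the Gaussian factor, the product rule gives the gradient
  \<open>E\<close> times \<open>g + (u \<rho> p / lam\<^sup>2) sgn x\<close>. The outer exponential
  cancels \<open>E\<^sup>2\<close>, and the three terms are the expanded square.\<close>

lemma gaussian_gradient_square:
  fixes u :: "'a::euclidean_space \<Rightarrow> real"
  assumes u: "GDERIV u x :> g" and x: "x \<in> hyp_space" "x \<noteq> 0" and lam: "lam \<noteq> 0"
  shows "exp (- ((hyp_rho x)\<^sup>2 / lam\<^sup>2)) *
      (hyp_norm x (hyp_grad (\<lambda>y. u y * exp ((hyp_rho y)\<^sup>2 / (2 * lam\<^sup>2))) x))\<^sup>2
    = (g \<bullet> g) / (conformal_factor x)\<^sup>2
      + 2 * u x * (hyp_rho x / norm x) * (x \<bullet> g) / conformal_factor x / lam\<^sup>2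
      + (hyp_rho x)\<^sup>2 * (u x)\<^sup>2 / (lam\<^sup>2)\<^sup>2"
proof -
  define \<rho> p E where "\<rho> = hyp_rho x" and "p = conformal_factor x" and "E = exp (\<rho>\<^sup>2 / (2 * lam\<^sup>2))"
  have "p > 0"
    using conformal_factor_pos[OF x(1)] by (simp add: p_def)
  have dexp: "((\<lambda>t. exp (t\<^sup>2 / (2 * lam\<^sup>2))) has_real_derivative E * (\<rho> / lam\<^sup>2)) (at \<rho>)"
    unfolding E_def by (auto intro!: derivative_eq_intros simp: lam power2_eq_square)
  have "GDERIV (\<lambda>y. u y * exp ((hyp_rho y)\<^sup>2 / (2 * lam\<^sup>2))) x :> E *\<^sub>R (g + (u x * \<rho> * p / lam\<^sup>2) *\<^sub>R sgn x)"
    by (rule GDERIV_subst[OF GDERIV_mult[OF u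
            GDERIV_DERIV_compose[OF gderiv_hyp_rho[OF x] dexp[unfolded \<rho>_def]]]])
       (simp add: E_def \<rho>_def p_def scaleR_add_right mult_ac)
  note grad = euclidean_gradI[OF this]
  have sgn: "sgn x \<bullet> sgn x = 1" "g \<bullet> sgn x = (x \<bullet> g) / norm x"
    using x(2) by (auto simp: norm_sgn dot_square_norm sgn_div_norm inner_commute divide_inverse)
  have "exp (- (\<rho>\<^sup>2 / lam\<^sup>2)) * E\<^sup>2 = 1"
    unfolding E_def by (simp add: exp_minus field_simps flip: exp_of_nat_mult exp_double)
  moreover have "(E *\<^sub>R (g + (u x * \<rho> * p / lam\<^sup>2) *\<^sub>R sgn x)) \<bullet> (E *\<^sub>R (g + (u x * \<rho> * p / lam\<^sup>2) *\<^sub>R sgn x))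
    = E\<^sup>2 * (g \<bullet> g + 2 * (u x * \<rho> * p / lam\<^sup>2) * ((x \<bullet> g) / norm x) + (u x * \<rho> * p / lam\<^sup>2)\<^sup>2)"
    by (simp add: inner_add_left inner_add_right sgn inner_commute[of "sgn x" g] power2_eq_square algebra_simps)
  ultimately have "exp (- (\<rho>\<^sup>2 / lam\<^sup>2)) *
      (hyp_norm x (hyp_grad (\<lambda>y. u y * exp ((hyp_rho y)\<^sup>2 / (2 * lam\<^sup>2))) x))\<^sup>2
    = (g \<bullet> g + 2 * (u x * \<rho> * p / lam\<^sup>2) * ((x \<bullet> g) / norm x) + (u x * \<rho> * p / lam\<^sup>2)\<^sup>2) / p\<^sup>2"
    unfolding hyp_norm_grad[OF x(1)] grad p_def[symmetric]
    by (simp add: mult.assoc[symmetric])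
  also have "\<dots> = (g \<bullet> g) / p\<^sup>2 + 2 * u x * (\<rho> / norm x) * (x \<bullet> g) / p / lam\<^sup>2
      + \<rho>\<^sup>2 * (u x)\<^sup>2 / (lam\<^sup>2)\<^sup>2"
    using \<open>p > 0\<close> lam x(2) by (simp add: field_simps power2_eq_square)
  finally show ?thesis
    by (simp add: \<rho>_def p_def)
qed

lemma integrable_hyp_vol_test_function:
  fixes u :: "'a::euclidean_space \<Rightarrow> real"
  assumes u: "test_function_on hyp_space u"
  shows "integrable hyp_vol (\<lambda>x. (euclidean_grad u x \<bullet> euclidean_grad u x) / (conformal_factor x)\<^sup>2)"
    and "integrable hyp_vol (\<lambda>x. (hyp_rho x)\<^sup>2 * (u x)\<^sup>2)"
proof -
  obtain R where R: "R < 1"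
    and u0: "\<And>x. x \<in> hyp_space \<Longrightarrow> norm x > R \<Longrightarrow> u x = 0"
    and g0: "\<And>x. x \<in> hyp_space \<Longrightarrow> norm x > R \<Longrightarrow> euclidean_grad u x = 0"
    using test_function_support_radius[OF u] by blast
  have int: "integrable hyp_vol f"
    if "continuous_on hyp_space f" "\<And>x. x \<in> hyp_space \<Longrightarrow> norm x > R \<Longrightarrow> f x = 0" for f :: "'a \<Rightarrow> real"
    using that R
    by (intro integrable_hyp_vol_bounded[OF _ R] measurable_hyp_vol_continuous
        bounded_continuous_on_hyp_space) auto
  note cont = test_function_continuous[OF u] test_function_continuous_grad[OF u]
    continuous_on_hyp_rho continuous_on_conformal_factor
  show "integrable hyp_vol (\<lambda>x. (euclidean_grad u x \<bullet> euclidean_grad u x) / (conformal_factor x)\<^sup>2)"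
    using g0 by (intro int continuous_intros cont) (auto dest: conformal_factor_pos)
  show "integrable hyp_vol (\<lambda>x. (hyp_rho x)\<^sup>2 * (u x)\<^sup>2)"
    using u0 by (intro int continuous_intros cont) auto
qed

theorem theorem1p3:
  fixes u :: "'a::euclidean_space \<Rightarrow> real" and lam :: real
  assumes "test_function_on hyp_space u"
    and "\<exists>x\<in>hyp_space. u x \<noteq> 0"
    and "lam = root 4 ((\<integral>x. (hyp_rho x)\<^sup>2 * \<bar>u x\<bar>\<^sup>2 \<partial>hyp_vol)
                       / (\<integral>x. (hyp_norm x (hyp_grad u x))\<^sup>2 \<partial>hyp_vol))"
  shows "sqrt (\<integral>x. (hyp_norm x (hyp_grad u x))\<^sup>2 \<partial>hyp_vol)
           * sqrt (\<integral>x. (hyp_rho x)\<^sup>2 * \<bar>u x\<bar>\<^sup>2 \<partial>hyp_vol)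
         - 1 / 2 * (\<integral>x. (real DIM('a) + (real DIM('a) - 1) *
               ((hyp_rho x * cosh (hyp_rho x) - sinh (hyp_rho x)) / sinh (hyp_rho x)))
               * \<bar>u x\<bar>\<^sup>2 \<partial>hyp_vol)
       = lam\<^sup>2 / 2 * (\<integral>x. exp (- ((hyp_rho x)\<^sup>2 / lam\<^sup>2)) *
             (hyp_norm x (hyp_grad (\<lambda>y. u y * exp ((hyp_rho y)\<^sup>2 / (2 * lam\<^sup>2))) x))\<^sup>2 \<partial>hyp_vol)"
proof -
  note u = assms(1)
  \<comment> \<open>\<open>a\<close>, \<open>b\<close> and \<open>k\<close> are the densities of the
    three integrals on the left, and \<open>c\<close> is the cross term.\<close>
  define a where "a x = (euclidean_grad u x \<bullet> euclidean_grad u x) / (conformal_factor x)\<^sup>2" for x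
  define b where "b x = (hyp_rho x)\<^sup>2 * (u x)\<^sup>2" for x
  define k where "k x = radial_kernel x * (u x)\<^sup>2" for x
  define c where "c x = 2 * u x * (hyp_rho x / norm x) * (x \<bullet> euclidean_grad u x) / conformal_factor x" for x
  define A B K where "A = (\<integral>x. a x \<partial>hyp_vol)" and "B = (\<integral>x. b x \<partial>hyp_vol)" and "K = (\<integral>x. k x \<partial>hyp_vol)"
  have int: "integrable hyp_vol a" "integrable hyp_vol b" "integrable hyp_vol k" "integrable hyp_vol c"
    using integrable_hyp_vol_test_function[OF u] integral_radial_by_parts(1,2)[OF u]
    by (simp_all add: a_def[abs_def] b_def[abs_def] c_def[abs_def] k_def[abs_def])
  have c_K: "(\<integral>x. c x \<partial>hyp_vol) = - K"
    using integral_radial_by_parts(3)[OF u] by (simp add: c_def K_def k_def)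
  have A_eq: "(\<integral>x. (hyp_norm x (hyp_grad u x))\<^sup>2 \<partial>hyp_vol) = A"
    unfolding A_def by (rule integral_hyp_vol_cong) (simp add: hyp_norm_grad a_def)
  have B_eq: "(\<integral>x. (hyp_rho x)\<^sup>2 * \<bar>u x\<bar>\<^sup>2 \<partial>hyp_vol) = B"
    by (simp add: B_def b_def)
  have K_eq: "(\<integral>x. (real DIM('a) + (real DIM('a) - 1) *
      ((hyp_rho x * cosh (hyp_rho x) - sinh (hyp_rho x)) / sinh (hyp_rho x))) * \<bar>u x\<bar>\<^sup>2 \<partial>hyp_vol) = K"
    unfolding K_def by (rule integral_hyp_vol_cong) (simp only: radial_kernel_eq k_def power2_abs not_False_eq_True)
  have in_space: "AE x in (hyp_vol :: 'a measure). x \<in> hyp_space \<and> x \<noteq> 0"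
    using AE_hyp_vol_nonzero AE_space[of "hyp_vol :: 'a measure"] by eventually_elim simp
  note nz = test_function_not_AE_zero[OF u assms(2)]
  \<comment> \<open>The distance vanishes only at the origin, so \<open>B = 0\<close> would force
    \<open>u = 0\<close> almost everywhere.\<close>
  have "B \<noteq> 0"
  proof
    assume "B = 0"
    then have "AE x in hyp_vol. b x = 0"
      unfolding B_def by (subst (asm) integral_nonneg_eq_0_iff_AE[OF int(2)]) (auto simp: b_def)
    with in_space have "AE x in hyp_vol. u x = 0"
      by eventually_elim (auto simp: b_def hyp_rho_eq_0_iff)
    with nz show False ..
  qed
  moreover have "B \<ge> 0"
    unfolding B_def b_def by (intro Bochner_Integration.integral_nonneg) auto
  ultimately have "B > 0"
    by simp
  have "A \<noteq> 0"
  proof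
    assume "A = 0"
    then have "AE x in hyp_vol. a x = 0"
      unfolding A_def by (subst (asm) integral_nonneg_eq_0_iff_AE[OF int(1)]) (auto simp: a_def)
    \<comment> \<open>A vanishing gradient kills the cross term, so \<open>K = 0\<close>; positivity
      of the kernel then forces \<open>u = 0\<close> almost everywhere.\<close>
    with in_space have "AE x in hyp_vol. c x = 0"
      by eventually_elim (auto simp: a_def c_def dest: conformal_factor_pos)
    then have "(\<integral>x. c x \<partial>hyp_vol) = 0"
      by (rule integral_eq_zero_AE)
    then have "(\<integral>x. k x \<partial>hyp_vol) = 0"
      using c_K by (simp add: K_def)
    moreover have "AE x in hyp_vol. 0 \<le> k x"
      using in_space by eventually_elim (auto simp: k_def intro!: mult_nonneg_nonneg less_imp_le[OF radial_kernel_pos])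
    ultimately have "AE x in hyp_vol. k x = 0"
      using integral_nonneg_eq_0_iff_AE[OF int(3)] by simp
    with in_space have "AE x in hyp_vol. u x = 0"
      by eventually_elim (auto simp: k_def dest: radial_kernel_pos)
    with nz show False ..
  qed
  moreover have "A \<ge> 0"
    unfolding A_def a_def by (intro Bochner_Integration.integral_nonneg) auto
  ultimately have "A > 0"
    by simp
  have lam: "lam = root 4 (B / A)"
    using assms(3) unfolding A_eq B_eq .
  have "lam > 0"
    using \<open>A > 0\<close> \<open>B > 0\<close> by (simp add: lam)
  have "(lam\<^sup>2)\<^sup>2 = B / A"
    using \<open>A > 0\<close> \<open>B > 0\<close> unfolding lam by (simp flip: power_mult)
  then have lam2: "lam\<^sup>2 = sqrt B / sqrt A"
    by (metis real_sqrt_divide real_sqrt_unique zero_le_power2)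
  have "(\<integral>x. exp (- ((hyp_rho x)\<^sup>2 / lam\<^sup>2)) *
      (hyp_norm x (hyp_grad (\<lambda>y. u y * exp ((hyp_rho y)\<^sup>2 / (2 * lam\<^sup>2))) x))\<^sup>2 \<partial>hyp_vol)
    = (\<integral>x. a x + c x / lam\<^sup>2 + b x / (lam\<^sup>2)\<^sup>2 \<partial>hyp_vol)"
    using \<open>lam > 0\<close> unfolding a_def b_def c_def
    by (intro integral_hyp_vol_cong gaussian_gradient_square test_function_gderiv[OF u]) auto
  also have "\<dots> = A - K / lam\<^sup>2 + B / (lam\<^sup>2)\<^sup>2"
    using int c_K by (simp add: A_def B_def)
  finally have rhs: "(\<integral>x. exp (- ((hyp_rho x)\<^sup>2 / lam\<^sup>2)) *
      (hyp_norm x (hyp_grad (\<lambda>y. u y * exp ((hyp_rho y)\<^sup>2 / (2 * lam\<^sup>2))) x))\<^sup>2 \<partial>hyp_vol)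
    = A - K / lam\<^sup>2 + B / (lam\<^sup>2)\<^sup>2" .
  define \<alpha> \<beta> where "\<alpha> = sqrt A" and "\<beta> = sqrt B"
  have \<alpha>\<beta>: "\<alpha> > 0" "\<beta> > 0" "A = \<alpha>\<^sup>2" "B = \<beta>\<^sup>2"
    using \<open>A > 0\<close> \<open>B > 0\<close> by (auto simp: \<alpha>_def \<beta>_def)
  \<comment> \<open>For \<open>lam\<^sup>2 = \<beta> / \<alpha>\<close> the terms \<open>A\<close>
    and \<open>B / (lam\<^sup>2)\<^sup>2\<close> both equal \<open>\<alpha>\<^sup>2\<close>. In
    terms of the square roots the claim is a rational identity.\<close>
  have "\<alpha> * \<beta> - 1 / 2 * K = (\<beta> / \<alpha>) / 2 * (\<alpha>\<^sup>2 - K / (\<beta> / \<alpha>) + \<beta>\<^sup>2 / (\<beta> / \<alpha>)\<^sup>2)"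
    using \<alpha>\<beta>(1,2) by (simp add: field_simps power2_eq_square)
  then show ?thesis
    unfolding A_eq B_eq K_eq rhs
    unfolding lam2
    unfolding \<alpha>_def[symmetric] \<beta>_def[symmetric]
    unfolding \<alpha>\<beta>(3,4) .
qed

end
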